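(* Let $\alpha$ be a nonzero integer and let $(h_n)$ be the sequence with $h_0=0$, $h_1=1$, $h_2=-\alpha$, $h_3=-\alpha^3$, $h_4=0$, and for $m\ge2$: $h_{2m+1}=h_{m+2}h_m^3-h_{m-1}h_{m+1}^3$, for $m\ge 3$: $h_{2m}=h_m\big(h_{m+2}h_{m-1}^2-h_{m-2}h_{m+1}^2\big)/h_2$. (i) If $n\equiv 1,7\pmod 8$, then $h_n$ is a square. (ii) If $n\equiv 1,3,5,7\pmod 8$, then $h_n$ is a cube.
   Context: The sequence defined is the elliptic divisibility sequence attached to the point $(0,0)$ of order $4$ on the curve $y^2+xy-\alpha y=x^3-\alpha x^2$ (Tate normal form); its fourth term is zero. Convention: an integer $m$ is called a square if $m=\pm\beta^2$ for some nonzero integer $\beta$, and a cube if $m=\beta^3$ for some nonzero integer $\beta$. *)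

theory Defs
  imports Complex_Main "HOL-Number_Theory.Cong"
begin

text \<open>
  The sequence is taken in the rationals, so that the division in the even-index recurrence is
  exact division rather than the truncating integer \<open>div\<close>. The integrality of its terms is thus
  not built into the definition.
\<close>

function h :: "int \<Rightarrow> nat \<Rightarrow> rat" where
  "h \<alpha> 0 = 0"
| "h \<alpha> (Suc 0) = 1"
| "h \<alpha> 2 = - of_int \<alpha>"
| "h \<alpha> 3 = - (of_int \<alpha> ^ 3)"
| "h \<alpha> 4 = 0"
| "m \<ge> 2 \<Longrightarrow> h \<alpha> (2 * m + 1) =
     h \<alpha> (m + 2) * h \<alpha> m ^ 3 - h \<alpha> (m - 1) * h \<alpha> (m + 1) ^ 3"
| "m \<ge> 3 \<Longrightarrow> h \<alpha> (2 * m) =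
     h \<alpha> m * (h \<alpha> (m + 2) * h \<alpha> (m - 1) ^ 2 - h \<alpha> (m - 2) * h \<alpha> (m + 1) ^ 2) / h \<alpha> 2"
proof goal_cases
  case (1 P x)
  obtain \<alpha> n where x: "x = (\<alpha>, n)" by force
  consider "n = 0" | "n = Suc 0" | "n = 2" | "n = 3" | "n = 4"
    | m where "n = 2 * m + 1" "m \<ge> 2" | m where "n = 2 * m" "m \<ge> 3"
  proof -
    have "n = 2 * (n div 2) \<or> n = 2 * (n div 2) + 1" by presburger
    moreover have "n \<in> {0, 1, 2, 3, 4} \<or> n \<ge> 5" by auto
    ultimately show thesis
      using that by (cases "even n") (auto elim!: evenE oddE)
  qed
  then show P using 1 x by cases blast+
qed (simp_all, presburger+)
termination by (relation "measure snd") auto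

definition is_square_pm :: "int \<Rightarrow> bool" where
  "is_square_pm m \<longleftrightarrow> (\<exists>\<beta>::int. \<beta> \<noteq> 0 \<and> (m = \<beta> ^ 2 \<or> m = - (\<beta> ^ 2)))"

definition is_cube_nz :: "int \<Rightarrow> bool" where
  "is_cube_nz m \<longleftrightarrow> (\<exists>\<beta>::int. \<beta> \<noteq> 0 \<and> m = \<beta> ^ 3)"

end

theory Submission imports Defs begin

text \<open>
  Since the base point has order 4, every fourth term vanishes, so each recurrence collapses to a single product
  and every other term is plus or minus a power of \<open>\<alpha>\<close>. For odd \<open>n\<close> the exponent is
  \<open>3 * ((n ^ 2 - 1) / 8)\<close>, where \<open>(n ^ 2 - 1) / 8\<close> is even exactly when \<open>n\<close> is congruent to
  1 or 7 modulo 8.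
\<close>

text \<open>The index enters through an equation so that the rule can be applied to indices such as
  \<open>4 * k + 1\<close>, with the halved index \<open>m\<close> supplied explicitly.\<close>

lemma h_odd_rec:
  assumes "n = 2 * m + 1" "m \<ge> 2"
  shows "h \<alpha> n = h \<alpha> (m + 2) * h \<alpha> m ^ 3 - h \<alpha> (m - 1) * h \<alpha> (m + 1) ^ 3"
  using assms by (simp only: h.simps)

lemma h_even_rec:
  assumes "n = 2 * m" "m \<ge> 3"
  shows "h \<alpha> n =
    - (h \<alpha> m * (h \<alpha> (m + 2) * h \<alpha> (m - 1) ^ 2 - h \<alpha> (m - 2) * h \<alpha> (m + 1) ^ 2)) / of_int \<alpha>"
  using assms by (simp only: h.simps divide_minus_right minus_divide_left)

text \<open>The terms at 5, 6 and 7 form the block \<open>k = 1\<close> of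
  \<open>h_closed_form\<close>. They are computed separately because the recurrences at 6 and 7
  refer to the term at 5, in the same block, which induction over blocks cannot supply.\<close>

lemma h_values:
  assumes "\<alpha> \<noteq> 0"
  shows "h \<alpha> 1 = 1" "h \<alpha> 5 = of_int \<alpha> ^ 9" "h \<alpha> 6 = of_int \<alpha> ^ 13" "h \<alpha> 7 = - (of_int \<alpha> ^ 18)"
proof -
  show one: "h \<alpha> 1 = 1" by simp
  show five: "h \<alpha> 5 = of_int \<alpha> ^ 9"
    by (subst h_odd_rec[of _ 2]) (simp_all add: one power_mult_distrib flip: power_mult)
  show "h \<alpha> 6 = of_int \<alpha> ^ 13"
    using assms
    by (subst h_even_rec[of _ 3])
      (simp_all add: one five field_simps flip: power_mult power_add power_Suc)
  show "h \<alpha> 7 = - (of_int \<alpha> ^ 18)"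
    by (subst h_odd_rec[of _ 3]) (simp_all add: five flip: power_mult power_add)
qed

text \<open>The recurrence at an index near \<open>4 * k\<close> refers to indices near
  \<open>2 * k\<close>, hence strong induction on \<open>k\<close>. For \<open>n = 4 * k + 2\<close>
  the exponent is \<open>(3 * n ^ 2 - 4) / 8\<close>.\<close>

lemma h_closed_form:
  fixes \<alpha> :: int
  assumes "\<alpha> \<noteq> 0"
  defines "a \<equiv> of_int \<alpha> :: rat"
  shows "h \<alpha> (4 * k) = 0 \<and>
    h \<alpha> (4 * k + 1) = a ^ (3 * (2 * k\<^sup>2 + k)) \<and>
    h \<alpha> (4 * k + 2) = (-1) ^ (k + 1) * a ^ (6 * k\<^sup>2 + 6 * k + 1) \<and>
    h \<alpha> (4 * k + 3) = - (a ^ (3 * (2 * k\<^sup>2 + 3 * k + 1)))"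
proof (induction k rule: less_induct)
  case (less k)
  have a0: "a \<noteq> 0" using assms by simp
  note IH = less.IH[THEN conjunct1] less.IH[THEN conjunct2, THEN conjunct1]
    less.IH[THEN conjunct2, THEN conjunct2, THEN conjunct1]
    less.IH[THEN conjunct2, THEN conjunct2, THEN conjunct2]
  \<comment> \<open>The parity of \<open>k\<close> decides the residue of \<open>2 * k\<close>
    modulo 4, and so which factors in the recurrences vanish.\<close>
  have "k = 0 \<or> k = 1 \<or> (\<exists>i. k = 2 * i + 2) \<or> (\<exists>i. k = 2 * i + 3)"
    by presburger
  then consider "k = 0" | "k = 1" | i where "k = 2 * i + 2" | i where "k = 2 * i + 3"
    by blast
  then show ?case
  proof cases
    case 1
    then show ?thesis by (simp add: a_def del: add_2_eq_Suc')
  next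
    case 2
    then show ?thesis using h_values[OF assms(1)] by (simp add: a_def)
  next
    case k: (3 i)
    have lt: "i < k" "i + 1 < k" using k by auto
    note lo = IH[OF lt(1)] and hi = IH[OF lt(2)]
    have z: "h \<alpha> (4 * i + 4) = 0" "h \<alpha> (4 + 4 * i) = 0"
      using hi(1) by (simp_all add: algebra_simps)
    \<comment> \<open>This is block \<open>i + 1\<close>; its sign \<open>(-1) ^ (i + 2)\<close> is
      simplified to \<open>(-1) ^ i\<close>.\<close>
    have e: "h \<alpha> (4 * i + 5) = a ^ (3 * (2 * (i+1)\<^sup>2 + (i+1)))"
      "h \<alpha> (4 * i + 6) = (-1) ^ i * a ^ (6 * (i+1)\<^sup>2 + 6 * (i+1) + 1)"
      "h \<alpha> (4 * i + 7) = - (a ^ (3 * (2 * (i+1)\<^sup>2 + 3 * (i+1) + 1)))"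
      using hi by (simp_all add: algebra_simps)
    \<comment> \<open>The leading factor of the recurrence, at index
      \<open>2 * k = 4 * i + 4\<close>, is zero.\<close>
    have "h \<alpha> (4 * k) = 0"
      by (subst h_even_rec[of _ "4 * i + 4"]) (simp_all add: k z add.commute)
    moreover have "h \<alpha> (4 * k + 1) = a ^ (3 * (2 * k\<^sup>2 + k))"
    proof -
      have "h \<alpha> (4 * k + 1) = - (h \<alpha> (4 * i + 3) * h \<alpha> (4 * i + 5) ^ 3)"
        by (subst h_odd_rec[of _ "4 * i + 4"]) (simp_all add: k z add.commute)
      then show ?thesis
        unfolding e lo
        by (simp add: k power2_eq_square algebra_simps flip: power_mult power_add)
    qed
    moreover have "h \<alpha> (4 * k + 2) = (-1) ^ (k + 1) * a ^ (6 * k\<^sup>2 + 6 * k + 1)"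
    proof -
      have "h \<alpha> (4 * k + 2) = h \<alpha> (4 * i + 5) * h \<alpha> (4 * i + 3) * h \<alpha> (4 * i + 6) ^ 2 / a"
        by (subst h_even_rec[of _ "4 * i + 5"]) (simp_all add: k z a_def add.commute)
      \<comment> \<open>Squaring removes the sign of the term at \<open>4 * i + 6\<close>, so the
        minus comes from \<open>4 * i + 3\<close> alone. The extra factor \<open>a\<close> cancels
        the denominator.\<close>
      also have "\<dots> = - (a ^ Suc (6 * k\<^sup>2 + 6 * k + 1)) / a"
        unfolding e lo
        by (simp add: k power2_eq_square algebra_simps flip: power_mult power_add)
      finally have "h \<alpha> (4 * k + 2) = \<dots>" .
      moreover have "(-1 :: rat) ^ (k + 1) = -1"
        by (simp add: k)
      ultimately show ?thesis
        using a0 by (simp only: power_Suc) simp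
    qed
    moreover have "h \<alpha> (4 * k + 3) = - (a ^ (3 * (2 * k\<^sup>2 + 3 * k + 1)))"
    proof -
      have "h \<alpha> (4 * k + 3) = h \<alpha> (4 * i + 7) * h \<alpha> (4 * i + 5) ^ 3"
        by (subst h_odd_rec[of _ "4 * i + 5"]) (simp_all add: k z add.commute)
      then show ?thesis
        unfolding e lo
        by (simp add: k power2_eq_square algebra_simps flip: power_mult power_add)
    qed
    ultimately show ?thesis by blast
  next
    case k: (4 i)
    have lt: "i + 1 < k" "i + 2 < k" using k by auto
    note lo = IH[OF lt(1)] and hi = IH[OF lt(2)]
    have z: "h \<alpha> (4 * i + 4) = 0" "h \<alpha> (4 + 4 * i) = 0"
      "h \<alpha> (4 * i + 8) = 0" "h \<alpha> (8 + 4 * i) = 0"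
      using lo(1) hi(1) by (simp_all add: algebra_simps)
    have e: "h \<alpha> (4 * i + 5) = a ^ (3 * (2 * (i+1)\<^sup>2 + (i+1)))"
      "h \<alpha> (4 * i + 6) = (-1) ^ i * a ^ (6 * (i+1)\<^sup>2 + 6 * (i+1) + 1)"
      "h \<alpha> (4 * i + 7) = - (a ^ (3 * (2 * (i+1)\<^sup>2 + 3 * (i+1) + 1)))"
      "h \<alpha> (4 * i + 9) = a ^ (3 * (2 * (i+2)\<^sup>2 + (i+2)))"
      using lo hi(1,2) by (simp_all add: algebra_simps)
    \<comment> \<open>Here \<open>2 * k = 4 * i + 6\<close>, and the bracket vanishes because both
      terms at distance two, \<open>4 * i + 4\<close> and \<open>4 * i + 8\<close>, are
      zero.\<close>
    have "h \<alpha> (4 * k) = 0"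
      by (subst h_even_rec[of _ "4 * i + 6"]) (simp_all add: k z add.commute)
    moreover have "h \<alpha> (4 * k + 1) = a ^ (3 * (2 * k\<^sup>2 + k))"
    proof -
      have "h \<alpha> (4 * k + 1) = - (h \<alpha> (4 * i + 5) * h \<alpha> (4 * i + 7) ^ 3)"
        by (subst h_odd_rec[of _ "4 * i + 6"]) (simp_all add: k z add.commute)
      then show ?thesis
        unfolding e
        by (simp add: k power2_eq_square algebra_simps flip: power_mult power_add)
    qed
    moreover have "h \<alpha> (4 * k + 2) = (-1) ^ (k + 1) * a ^ (6 * k\<^sup>2 + 6 * k + 1)"
    proof -
      have "h \<alpha> (4 * k + 2) = - (h \<alpha> (4 * i + 7) * h \<alpha> (4 * i + 9) * h \<alpha> (4 * i + 6) ^ 2) / a"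
        by (subst h_even_rec[of _ "4 * i + 7"]) (simp_all add: k z a_def add.commute)
      \<comment> \<open>The outer minus cancels the sign of the term at
        \<open>4 * i + 7\<close>.\<close>
      also have "\<dots> = a ^ Suc (6 * k\<^sup>2 + 6 * k + 1) / a"
        unfolding e
        by (simp add: k power2_eq_square algebra_simps flip: power_mult power_add)
      finally have "h \<alpha> (4 * k + 2) = \<dots>" .
      moreover have "(-1 :: rat) ^ (k + 1) = 1"
        by (simp add: k)
      ultimately show ?thesis
        using a0 by (simp only: power_Suc) simp
    qed
    moreover have "h \<alpha> (4 * k + 3) = - (a ^ (3 * (2 * k\<^sup>2 + 3 * k + 1)))"
    proof -
      have "h \<alpha> (4 * k + 3) = h \<alpha> (4 * i + 9) * h \<alpha> (4 * i + 7) ^ 3"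
        by (subst h_odd_rec[of _ "4 * i + 7"]) (simp_all add: k z add.commute)
      then show ?thesis
        unfolding e
        by (simp add: k power2_eq_square algebra_simps flip: power_mult power_add)
    qed
    ultimately show ?thesis by blast
  qed
qed

text \<open>Since -1 is its own cube, the sign moves into the base.\<close>

lemma is_cube_nz_power: "\<alpha> \<noteq> 0 \<Longrightarrow> is_cube_nz (\<alpha> ^ (3 * e))" "\<alpha> \<noteq> 0 \<Longrightarrow> is_cube_nz (- (\<alpha> ^ (3 * e)))"
  unfolding is_cube_nz_def
  by (rule exI[of _ "\<alpha> ^ e"], simp add: mult.commute flip: power_mult)
     (rule exI[of _ "- (\<alpha> ^ e)"], simp add: mult.commute flip: power_mult)

lemma is_square_pm_power:
  "\<alpha> \<noteq> 0 \<Longrightarrow> even e \<Longrightarrow> is_square_pm (\<alpha> ^ e)" "\<alpha> \<noteq> 0 \<Longrightarrow> even e \<Longrightarrow> is_square_pm (- (\<alpha> ^ e))"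
  unfolding is_square_pm_def
  by (rule exI[of _ "\<alpha> ^ (e div 2)"], simp flip: power_mult)+

theorem theorem5p1:
  fixes \<alpha> :: int and n :: nat
  assumes "\<alpha> \<noteq> 0"
  shows "([n = 1] (mod 8) \<or> [n = 7] (mod 8) \<longrightarrow>
            (\<exists>k::int. h \<alpha> n = of_int k \<and> is_square_pm k))
       \<and> ([n = 1] (mod 8) \<or> [n = 3] (mod 8) \<or> [n = 5] (mod 8) \<or> [n = 7] (mod 8) \<longrightarrow>
            (\<exists>k::int. h \<alpha> n = of_int k \<and> is_cube_nz k))"
proof (intro conjI impI)
  have one: "h \<alpha> (4 * k + 1) = of_int (\<alpha> ^ (3 * (2 * k\<^sup>2 + k)))" for k
    using h_closed_form[OF assms, of k] by simp
  have three: "h \<alpha> (4 * k + 3) = of_int (- (\<alpha> ^ (3 * (2 * k\<^sup>2 + 3 * k + 1))))" for k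
    using h_closed_form[OF assms, of k] by simp
  {
    assume "[n = 1] (mod 8) \<or> [n = 7] (mod 8)"
    then have "n mod 8 = 1 \<or> n mod 8 = 7"
      by (simp add: cong_def)
    then have "n = 8 * (n div 8) + 1 \<or> n = 8 * (n div 8) + 7"
      by (metis mult_div_mod_eq)
    \<comment> \<open>In block \<open>k\<close> the exponents are three times
      \<open>k * (2 * k + 1)\<close> and \<open>(k + 1) * (2 * k + 1)\<close>: the first is even for
      even \<open>k\<close>, the second for odd \<open>k\<close>.\<close>
    then consider "n = 4 * (2 * (n div 8)) + 1" | "n = 4 * (2 * (n div 8) + 1) + 3"
      by fastforce
    then show "\<exists>k::int. h \<alpha> n = of_int k \<and> is_square_pm k"
    proof cases
      case 1
      show ?thesis
        by (subst 1, intro exI conjI, rule one, rule is_square_pm_power) (simp_all add: assms)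
    next
      case 2
      show ?thesis
        by (subst 2, intro exI conjI, rule three, rule is_square_pm_power) (simp_all add: assms)
    qed
  }
  assume "[n = 1] (mod 8) \<or> [n = 3] (mod 8) \<or> [n = 5] (mod 8) \<or> [n = 7] (mod 8)"
  then have "odd n"
    by (auto simp: cong_def) presburger+
  then have "n = 4 * (n div 4) + 1 \<or> n = 4 * (n div 4) + 3"
    by presburger
  then show "\<exists>k::int. h \<alpha> n = of_int k \<and> is_cube_nz k"
    by (metis one three is_cube_nz_power assms)
qed

end
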